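(* Let $\omega$ be a primitive cube root of unity and let $S=\left(\frac{1,1}{\mathbb{Q}(\omega),\omega}\right)$ be the symbol algebra of degree $3$. Then all Fibonacci symbol elements $F_n\in S$, $n\in\mathbb{N}$, are invertible elements of $S$.
   Context: The symbol algebra $\left(\frac{1,1}{K,\omega}\right)$ of degree $3$ over a field $K\ni\omega$ is the associative unital $K$-algebra generated by $x,y$ with $x^3=1$, $y^3=1$, $yx=\omega xy$; it has $K$-basis $\{x^iy^j:0\le i,j<3\}$. Fibonacci numbers: $f_0=0$, $f_1=1$, $f_{n+2}=f_{n+1}+f_n$ for $n\in\mathbb{N}$ ($\mathbb{N}$ includes $0$). The $n$-th Fibonacci symbol element is $$F_{n}=f_{n}\cdot 1+f_{n+1}x+f_{n+2}x^{2}+f_{n+3}y+f_{n+4}xy+f_{n+5}x^{2}y+f_{n+6}y^{2}+f_{n+7}xy^{2}+f_{n+8}x^{2}y^{2}.$$ *)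

theory Defs
  imports Complex_Main "HOL-Number_Theory.Fib" "HOL-Library.Numeral_Type"
    "HOL-Library.Product_Plus"
begin

definition primitive_root_of_unity :: "nat \<Rightarrow> 'k::field \<Rightarrow> bool" where
  "primitive_root_of_unity n \<omega> \<longleftrightarrow> n > 0 \<and> \<omega> ^ n = 1 \<and> (\<forall>k. 0 < k \<and> k < n \<longrightarrow> \<omega> ^ k \<noteq> 1)"

definition is_subfield :: "'k::field set \<Rightarrow> bool" where
  "is_subfield L \<longleftrightarrow> 0 \<in> L \<and> 1 \<in> L \<and>
     (\<forall>a\<in>L. \<forall>b\<in>L. a + b \<in> L \<and> a * b \<in> L) \<and> (\<forall>a\<in>L. - a \<in> L \<and> inverse a \<in> L)"

text \<open>In characteristic 0 the smallest subfield containing \<open>\<omega>\<close> is \<open>\<rat>(\<omega>)\<close>, since every subfield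
  contains the prime field \<open>\<rat>\<close>. A field type \<open>'k\<close> \<^emph>\<open>is\<close> \<open>\<rat>(\<omega>)\<close> when \<open>rat_adjoin \<omega> = UNIV\<close>.\<close>

definition rat_adjoin :: "'k::field_char_0 \<Rightarrow> 'k set" where
  "rat_adjoin \<omega> = \<Inter> {L. is_subfield L \<and> \<omega> \<in> L}"

text \<open>The type \<open>'a\<close>, with scalar multiplication \<open>scale\<close> over the field \<open>'k\<close> and generators \<open>x\<close>, \<open>y\<close>,
  is the symbol algebra of degree 3 with symbol \<open>(1,1 / 'k, \<omega>)\<close>. The relations and the basis
  determine it up to isomorphism; that the nine monomials span includes that \<open>x\<close>, \<open>y\<close> generate.
  Together, \<open>inj_on\<close> and \<open>independent\<close> state linear independence of the family of monomials.\<close>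

locale symbol_algebra_3 = vector_space scale
  for scale :: "'k::field \<Rightarrow> 'a::ring_1 \<Rightarrow> 'a" +
  fixes \<omega> :: 'k and x y :: 'a
  assumes scale_mult_left: "scale c u * v = scale c (u * v)"
    and scale_mult_right: "u * scale c v = scale c (u * v)"
    and x_cube: "x ^ 3 = 1"
    and y_cube: "y ^ 3 = 1"
    and y_x: "y * x = scale \<omega> (x * y)"
    and monomials_inj: "inj_on (\<lambda>(i, j). x ^ i * y ^ j) ({..<3} \<times> {..<3})"
    and monomials_independent: "independent ((\<lambda>(i, j). x ^ i * y ^ j) ` ({..<3} \<times> {..<3}))"
    and monomials_span: "span ((\<lambda>(i, j). x ^ i * y ^ j) ` ({..<3} \<times> {..<3})) = UNIV"

definition fib_symbol :: "('k::field \<Rightarrow> 'a::ring_1 \<Rightarrow> 'a) \<Rightarrow> 'a \<Rightarrow> 'a \<Rightarrow> nat \<Rightarrow> 'a" where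
  "fib_symbol scale x y n = (let f = (\<lambda>k. of_nat (fib k)) in
       scale (f n) 1 + scale (f (n + 1)) x + scale (f (n + 2)) (x ^ 2)
     + scale (f (n + 3)) y + scale (f (n + 4)) (x * y) + scale (f (n + 5)) (x ^ 2 * y)
     + scale (f (n + 6)) (y ^ 2) + scale (f (n + 7)) (x * y ^ 2) + scale (f (n + 8)) (x ^ 2 * y ^ 2))"

definition is_invertible :: "'a::monoid_mult \<Rightarrow> bool" where
  "is_invertible u \<longleftrightarrow> (\<exists>v. u * v = 1 \<and> v * u = 1)"


subsection \<open>The hypotheses are satisfiable\<close>

text \<open>A model of \<open>\<rat>(\<omega>)\<close>: the pair \<open>(a, b)\<close> stands for \<open>a + b\<omega>\<close>.\<close>

typedef qomega = "UNIV :: (rat \<times> rat) set" by simp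

setup_lifting type_definition_qomega

lemma qomega_norm_nonzero:
  assumes "a \<noteq> 0 \<or> b \<noteq> (0::rat)"
  shows "a * a - a * b + b * b \<noteq> 0"
proof (cases "b = 0")
  case True
  then show ?thesis using assms by simp
next
  case False
  define s where "s = (2 * a - b) * (2 * a - b)"
  define t where "t = b * b"
  have "4 * (a * a - a * b + b * b) = s + 3 * t"
    by (simp add: s_def t_def algebra_simps)
  moreover have "s \<ge> 0" "t \<ge> 0" "t \<noteq> 0" using False by (simp_all add: s_def t_def)
  ultimately show ?thesis by force
qed

instantiation qomega :: field
begin
lift_definition zero_qomega :: qomega is "(0, 0)" .
lift_definition one_qomega :: qomega is "(1, 0)" .
lift_definition plus_qomega :: "qomega \<Rightarrow> qomega \<Rightarrow> qomega" is
  "\<lambda>(a, b) (c, d). (a + c, b + d)" .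
lift_definition minus_qomega :: "qomega \<Rightarrow> qomega \<Rightarrow> qomega" is
  "\<lambda>(a, b) (c, d). (a - c, b - d)" .
lift_definition uminus_qomega :: "qomega \<Rightarrow> qomega" is "\<lambda>(a, b). (- a, - b)" .
lift_definition times_qomega :: "qomega \<Rightarrow> qomega \<Rightarrow> qomega" is
  "\<lambda>(a, b) (c, d). (a * c - b * d, a * d + b * c - b * d)" .
lift_definition inverse_qomega :: "qomega \<Rightarrow> qomega" is
  "\<lambda>(a, b). ((a - b) / (a * a - a * b + b * b), - b / (a * a - a * b + b * b))" .
definition divide_qomega :: "qomega \<Rightarrow> qomega \<Rightarrow> qomega" where
  "divide_qomega u v = u * inverse v"
instance
proof
  fix u v w :: qomega
  show "u * v * w = u * (v * w)" by transfer (auto simp: algebra_simps)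
  show "u * v = v * u" by transfer (auto simp: algebra_simps)
  show "1 * u = u" by transfer auto
  show "u + v + w = u + (v + w)" by transfer auto
  show "u + v = v + u" by transfer auto
  show "0 + u = u" by transfer auto
  show "- u + u = 0" by transfer auto
  show "u - v = u + - v" by transfer auto
  show "(u + v) * w = u * w + v * w" by transfer (auto simp: algebra_simps)
  show "(0::qomega) \<noteq> 1" by transfer auto
  show "inverse u * u = 1" if "u \<noteq> 0"
    using that
  proof (transfer, goal_cases)
    case (1 u)
    obtain a b where u: "u = (a, b)" by (cases u)
    then have "a * a - a * b + b * b \<noteq> 0" using 1 qomega_norm_nonzero[of a b] by auto
    then show ?case by (simp add: u divide_simps) (simp add: algebra_simps)
  qed
  show "u div v = u * inverse v" by (rule divide_qomega_def)
  show "inverse (0::qomega) = 0" by transfer auto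
qed
end

lemma of_nat_qomega: "of_nat n = Abs_qomega (of_nat n, 0)"
  by (induction n) (simp_all add: zero_qomega_def one_qomega_def plus_qomega.abs_eq)

instance qomega :: field_char_0
  by standard (auto simp: inj_on_def of_nat_qomega Abs_qomega_inject)

lift_definition om :: qomega is "(0, 1)" .

lemma om_sq: "om * om = - 1 - om" by transfer auto

lemma om_cube: "om * (om * om) = 1" by transfer auto

lemma om_primitive: "primitive_root_of_unity 3 om"
proof -
  have "om \<noteq> 1" by transfer auto
  moreover have "om ^ 2 \<noteq> 1" unfolding power2_eq_square by transfer auto
  moreover have "om ^ k = om \<or> om ^ k = om ^ 2" if "0 < k" "k < 3" for k :: nat
  proof -
    have "k = 1 \<or> k = 2" using that by auto
    then show ?thesis by auto
  qed
  moreover have "om ^ 3 = 1" using om_cube by (simp add: power3_eq_cube mult.assoc)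
  ultimately show ?thesis
    unfolding primitive_root_of_unity_def by (metis zero_less_numeral)
qed

lemma rat_adjoin_om: "rat_adjoin om = UNIV"
proof -
  have "z \<in> L" if L: "is_subfield L" "om \<in> L" for L z
  proof -
    have add: "a + b \<in> L" and mul: "a * b \<in> L" if "a \<in> L" "b \<in> L" for a b
      using L that by (auto simp: is_subfield_def)
    have neg: "- a \<in> L" and inv: "inverse a \<in> L" if "a \<in> L" for a
      using L that by (auto simp: is_subfield_def)
    have nat: "of_nat n \<in> L" for n
      using L by (induction n) (auto simp: is_subfield_def)
    have int: "of_int i \<in> L" for i
      by (cases i) (use nat neg in \<open>auto simp del: of_nat_Suc\<close>)
    have rat: "of_rat r \<in> L" for r
      by (cases r) (use mul int inv in \<open>auto simp: of_rat_rat divide_inverse\<close>)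
    have of_int: "of_int i = Abs_qomega (of_int i, 0)" for i
      by (cases i)
        (auto simp: of_nat_qomega uminus_qomega.abs_eq zero_qomega_def one_qomega_def plus_qomega.abs_eq simp del: of_nat_Suc)
    have of_rat: "of_rat r = Abs_qomega (r, 0)" for r
    proof -
      obtain i j where r: "r = of_int i / of_int j" and j: "j > 0"
        by (metis quotient_of_denom_pos' quotient_of_div surjective_pairing)
      have "Abs_qomega (r, 0) * of_int j = of_int i"
        using j by (simp add: of_int times_qomega.abs_eq r)
      then have "Abs_qomega (r, 0) = of_int i / of_int j"
        using j by (simp add: field_simps)
      then show ?thesis by (simp add: r of_rat_divide)
    qed
    obtain a b where "z = Abs_qomega (a, b)" by (cases z) auto
    then have "z = of_rat a + of_rat b * om"
      by (simp add: of_rat om_def times_qomega.abs_eq plus_qomega.abs_eq)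
    then show ?thesis using add mul rat L by auto
  qed
  then show ?thesis by (auto simp: rat_adjoin_def)
qed

text \<open>A model of the symbol algebra: \<open>u (i, j)\<close> is the coefficient of \<open>x\<^sup>i y\<^sup>j\<close>, with exponents in
  \<open>\<int>/3\<close>, and \<open>(x\<^sup>i y\<^sup>j) (x\<^sup>k y\<^sup>l) = \<omega>\<^sup>j\<^sup>k x\<^sup>i\<^sup>+\<^sup>k y\<^sup>j\<^sup>+\<^sup>l\<close>.\<close>

lemma UNIV_3: "(UNIV :: 3 set) = {0, 1, 2}"
  by (rule sym, rule card_subset_eq) auto

definition om_pow :: "3 \<Rightarrow> qomega" where
  "om_pow t = (if t = 0 then 1 else if t = 1 then om else om ^ 2)"

lemma three_cases: "t = 0 \<or> t = 1 \<or> t = (2::3)"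
  using UNIV_3 by auto

lemma om_pow_add: "om_pow (s + t) = om_pow s * om_pow t"
  using three_cases[of s] three_cases[of t] om_cube
  by (auto simp: om_pow_def power2_eq_square mult.assoc)

definition twist :: "3 \<times> 3 \<Rightarrow> 3 \<times> 3 \<Rightarrow> qomega" where
  "twist g h = om_pow (snd g * fst h)"

lemma twist_cocycle: "twist g h * twist (g + h) k = twist g (h + k) * twist h k"
  by (simp add: twist_def om_pow_add[symmetric] algebra_simps)

lemma twist_0 [simp]: "twist 0 g = 1" "twist g 0 = 1"
  by (simp_all add: twist_def om_pow_def)

typedef symb = "UNIV :: (3 \<times> 3 \<Rightarrow> qomega) set" by simp

lifting_forget qomega.lifting
setup_lifting type_definition_symb

instantiation symb :: ring_1
begin
lift_definition zero_symb :: symb is "\<lambda>_. 0" .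
lift_definition one_symb :: symb is "\<lambda>g. if g = 0 then 1 else 0" .
lift_definition plus_symb :: "symb \<Rightarrow> symb \<Rightarrow> symb" is "\<lambda>u v g. u g + v g" .
lift_definition minus_symb :: "symb \<Rightarrow> symb \<Rightarrow> symb" is "\<lambda>u v g. u g - v g" .
lift_definition uminus_symb :: "symb \<Rightarrow> symb" is "\<lambda>u g. - u g" .
lift_definition times_symb :: "symb \<Rightarrow> symb \<Rightarrow> symb" is
  "\<lambda>u v g. \<Sum>h\<in>UNIV. twist h (g - h) * u h * v (g - h)" .
instance
proof
  fix u v w :: symb
  show "u * v * w = u * (v * w)"
  proof (transfer, rule ext)
    fix u v w :: "3 \<times> 3 \<Rightarrow> qomega" and g
    have "(\<Sum>p\<in>UNIV. twist p (g - p) * (\<Sum>h\<in>UNIV. twist h (p - h) * u h * v (p - h)) * w (g - p))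
      = (\<Sum>p\<in>UNIV. \<Sum>h\<in>UNIV. twist h (p - h) * twist p (g - p) * u h * v (p - h) * w (g - p))"
      by (simp add: sum_distrib_left sum_distrib_right mult_ac)
    also have "\<dots> = (\<Sum>h\<in>UNIV. \<Sum>p\<in>UNIV. twist h (p - h) * twist p (g - p) * u h * v (p - h) * w (g - p))"
      by (rule sum.swap)
    also have "\<dots> = (\<Sum>h\<in>UNIV. \<Sum>k\<in>UNIV. twist h k * twist (h + k) (g - h - k) * u h * v k * w (g - h - k))"
    proof (rule sum.cong[OF refl])
      fix h :: "3 \<times> 3"
      show "(\<Sum>p\<in>UNIV. twist h (p - h) * twist p (g - p) * u h * v (p - h) * w (g - p))
        = (\<Sum>k\<in>UNIV. twist h k * twist (h + k) (g - h - k) * u h * v k * w (g - h - k))"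
        by (rule sum.reindex_bij_witness[of _ "\<lambda>k. h + k" "\<lambda>p. p - h"])
          (simp_all add: diff_diff_eq)
    qed
    also have "\<dots> = (\<Sum>h\<in>UNIV. \<Sum>k\<in>UNIV. twist h (g - h) * twist k (g - h - k) * u h * v k * w (g - h - k))"
    proof -
      have "twist h k * twist (h + k) (g - h - k) = twist h (g - h) * twist k (g - h - k)" for h k
        using twist_cocycle[of h k "g - h - k"] by simp
      then show ?thesis by simp
    qed
    also have "\<dots> = (\<Sum>h\<in>UNIV. twist h (g - h) * u h * (\<Sum>k\<in>UNIV. twist k (g - h - k) * v k * w (g - h - k)))"
      by (simp add: sum_distrib_left mult_ac)
    finally show "(\<Sum>p\<in>UNIV. twist p (g - p) * (\<Sum>h\<in>UNIV. twist h (p - h) * u h * v (p - h)) * w (g - p))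
      = (\<Sum>h\<in>UNIV. twist h (g - h) * u h * (\<Sum>k\<in>UNIV. twist k (g - h - k) * v k * w (g - h - k)))" .
  qed
  show "1 * u = u"
  proof (transfer, rule ext)
    fix u :: "3 \<times> 3 \<Rightarrow> qomega" and g
    have "(\<Sum>h\<in>UNIV. twist h (g - h) * (if h = 0 then 1 else 0) * u (g - h))
      = (\<Sum>h\<in>(UNIV :: (3 \<times> 3) set). if h = 0 then u g else 0)"
      by (intro sum.cong) auto
    then show "(\<Sum>h\<in>UNIV. twist h (g - h) * (if h = 0 then 1 else 0) * u (g - h)) = u g"
      by simp
  qed
  show "u * 1 = u"
  proof (transfer, rule ext)
    fix u :: "3 \<times> 3 \<Rightarrow> qomega" and g
    have "(\<Sum>h\<in>UNIV. twist h (g - h) * u h * (if g - h = 0 then 1 else 0))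
      = (\<Sum>h\<in>UNIV. if h = g then u g else 0)"
      by (intro sum.cong) auto
    then show "(\<Sum>h\<in>UNIV. twist h (g - h) * u h * (if g - h = 0 then 1 else 0)) = u g"
      by simp
  qed
  show "u + v + w = u + (v + w)" by transfer (simp add: add.assoc)
  show "u + v = v + u" by transfer (simp add: add.commute)
  show "0 + u = u" by transfer simp
  show "- u + u = 0" by transfer simp
  show "u - v = u + - v" by transfer simp
  show "(u + v) * w = u * w + v * w"
    by transfer (simp add: algebra_simps sum.distrib)
  show "u * (v + w) = u * v + u * w"
    by transfer (simp add: algebra_simps sum.distrib)
  show "(0::symb) \<noteq> 1" by transfer (auto simp: fun_eq_iff zero_prod_def)
qed
end

lift_definition symb_scale :: "qomega \<Rightarrow> symb \<Rightarrow> symb" is "\<lambda>c u g. c * u g" .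

lift_definition unit_vec :: "3 \<times> 3 \<Rightarrow> symb" is "\<lambda>g h. if h = g then 1 else 0" .

lemma unit_vec_mult: "unit_vec g * unit_vec h = symb_scale (twist g h) (unit_vec (g + h))"
proof (transfer, rule ext)
  fix g h k :: "3 \<times> 3"
  have "(\<Sum>l\<in>UNIV. twist l (k - l) * (if l = g then 1 else 0) * (if k - l = h then 1 else 0))
    = (\<Sum>l\<in>UNIV. if l = g then twist g (k - g) * (if k - g = h then 1 else 0) else 0)"
    by (intro sum.cong) auto
  also have "\<dots> = twist g h * (if k = g + h then 1 else 0)"
    by (auto simp: algebra_simps)
  finally show "(\<Sum>l\<in>UNIV. twist l (k - l) * (if l = g then 1 else 0) * (if k - l = h then 1 else 0))
    = twist g h * (if k = g + h then 1 else 0)" .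
qed

lemma unit_vec_0: "unit_vec 0 = 1" by transfer simp

lemma symb_scale_one: "symb_scale 1 u = u" by transfer simp

lemma unit_vec_power_x: "unit_vec (1, 0) ^ i = unit_vec (of_nat i, 0)"
  by (induction i) (simp_all add: unit_vec_0[symmetric] zero_prod_def unit_vec_mult twist_def
      om_pow_def symb_scale_one)

lemma unit_vec_power_y: "unit_vec (0, 1) ^ i = unit_vec (0, of_nat i)"
  by (induction i) (simp_all add: unit_vec_0[symmetric] zero_prod_def unit_vec_mult twist_def
      om_pow_def symb_scale_one)

lemma unit_vec_monomial: "unit_vec (1, 0) ^ i * unit_vec (0, 1) ^ j = unit_vec (of_nat i, of_nat j)"
  by (simp add: unit_vec_power_x unit_vec_power_y unit_vec_mult twist_def om_pow_def symb_scale_one)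

lemma unit_vec_inj: "inj unit_vec"
  by (rule injI, transfer) (metis one_neq_zero)

interpretation symb: vector_space symb_scale
  by standard (transfer; simp add: algebra_simps)+

lemma lessThan_3: "{..<3::nat} = {0, 1, 2}" by auto

lemma of_nat_bij: "bij_betw (\<lambda>(i, j). (of_nat i, of_nat j)) ({..<3::nat} \<times> {..<3::nat}) (UNIV :: (3 \<times> 3) set)"
proof -
  have "bij_betw of_nat {..<3::nat} (UNIV :: 3 set)"
    unfolding bij_betw_def UNIV_3 lessThan_3 by auto
  from bij_betw_map_prod[OF this this] show ?thesis by (simp add: map_prod_def)
qed

lemma unit_vec_expand: "u = (\<Sum>g\<in>UNIV. symb_scale (Rep_symb u g) (unit_vec g))"
proof -
  have rep_sum: "Rep_symb (sum f A) h = (\<Sum>a\<in>A. Rep_symb (f a) h)" if "finite A"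
    for f :: "3 \<times> 3 \<Rightarrow> symb" and A h
    using that by (induction A rule: finite_induct) (simp_all add: zero_symb.rep_eq plus_symb.rep_eq)
  have "Rep_symb u h = Rep_symb (\<Sum>g\<in>UNIV. symb_scale (Rep_symb u g) (unit_vec g)) h" for h
    by (simp add: rep_sum symb_scale.rep_eq unit_vec.rep_eq if_distrib[of "\<lambda>t. _ * t"] cong: if_cong)
  then show ?thesis by (intro Rep_symb_inject[THEN iffD1] ext)
qed

theorem symbol_algebra_3_model: "symbol_algebra_3 symb_scale om (unit_vec (1, 0)) (unit_vec (0, 1))"
proof
  let ?m = "\<lambda>(i, j). unit_vec (1, 0) ^ i * unit_vec (0, 1) ^ j"
  have m: "?m = unit_vec \<circ> (\<lambda>(i, j). (of_nat i, of_nat j))"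
    by (auto simp: fun_eq_iff unit_vec_monomial)
  have im: "?m ` ({..<3} \<times> {..<3}) = range unit_vec"
    unfolding m image_comp[symmetric] bij_betw_imp_surj_on[OF of_nat_bij] ..
  show "inj_on ?m ({..<3} \<times> {..<3})"
    unfolding m using of_nat_bij unit_vec_inj
    by (intro comp_inj_on) (auto simp: bij_betw_def intro: inj_on_subset)
  show "symb.independent (?m ` ({..<3} \<times> {..<3}))"
    unfolding im
  proof
    assume "symb.dependent (range unit_vec)"
    then obtain c g where c: "(\<Sum>v\<in>range unit_vec. symb_scale (c v) v) = 0" and g: "c (unit_vec g) \<noteq> 0"
      by (auto simp: symb.dependent_finite)
    have "(\<Sum>g\<in>UNIV. symb_scale (c (unit_vec g)) (unit_vec g)) = 0"
      using c by (simp add: sum.reindex[OF unit_vec_inj])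
    moreover have "Abs_symb (\<lambda>g. c (unit_vec g)) = (\<Sum>g\<in>UNIV. symb_scale (c (unit_vec g)) (unit_vec g))"
      by (rule trans[OF unit_vec_expand]) (simp add: Abs_symb_inverse)
    ultimately have "(\<lambda>g. c (unit_vec g)) = (\<lambda>g. 0)"
      by (simp add: zero_symb_def Abs_symb_inject)
    then show False using g by metis
  qed
  show "symb.span (?m ` ({..<3} \<times> {..<3})) = UNIV"
    unfolding im
  proof (rule UNIV_eq_I[symmetric])
    fix u
    have "(\<Sum>g\<in>UNIV. symb_scale (Rep_symb u g) (unit_vec g)) \<in> symb.span (range unit_vec)"
      by (intro symb.span_sum symb.span_scale symb.span_base rangeI)
    then show "u \<in> symb.span (range unit_vec)"
      by (simp only: unit_vec_expand[of u, symmetric])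
  qed
  have three: "of_nat 3 = (0 :: 3)" by simp
  show "unit_vec (1, 0) ^ 3 = 1" "unit_vec (0, 1) ^ 3 = 1"
    unfolding unit_vec_power_x unit_vec_power_y unit_vec_0[symmetric] zero_prod_def three by simp_all
  show "unit_vec (0, 1) * unit_vec (1, 0) = symb_scale om (unit_vec (1, 0) * unit_vec (0, 1))"
    by (simp add: unit_vec_mult twist_def om_pow_def symb_scale_one)
  fix c :: qomega and u v :: symb
  show "symb_scale c u * v = symb_scale c (u * v)"
    by transfer (simp add: sum_distrib_left mult_ac)
  show "u * symb_scale c v = symb_scale c (u * v)"
    by transfer (simp add: sum_distrib_left mult_ac)
qed

end

theory Submission
  imports Defs
begin

text \<open>In the split algebra the reduced norm of \<open>F\<^sub>n\<close> is a binary cubic form in \<open>a = f\<^sub>n\<close> and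
  \<open>b = f\<^sub>n\<^sub>+\<^sub>1\<close>. It is free of \<open>\<omega>\<close> and all its coefficients are positive integers, hence it does not
  vanish at Fibonacci numbers, and the reduced adjoint of \<open>F\<^sub>n\<close> divided by the norm is the inverse.\<close>

lemma primitive_cube_root_eq:
  assumes "primitive_root_of_unity 3 (\<omega> :: 'k::field)"
  shows "\<omega>\<^sup>2 + \<omega> + 1 = 0"
proof -
  have "\<omega> ^ 3 = 1" and "\<forall>k. 0 < k \<and> k < 3 \<longrightarrow> \<omega> ^ k \<noteq> 1"
    using assms by (simp_all add: primitive_root_of_unity_def)
  then have "(\<omega> - 1) * (\<omega>\<^sup>2 + \<omega> + 1) = 0"
    by (simp add: algebra_simps power2_eq_square power3_eq_cube)
  moreover have "\<omega> \<noteq> 1"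
    using \<open>\<forall>k. _\<close>[rule_format, of 1] by simp
  ultimately show ?thesis by simp
qed

text \<open>Lets the exponent \<open>p = (i + k) mod 3\<close> of a product replace \<open>k\<close>
  as summation index; the \<open>+ 3\<close> keeps subtraction on \<open>nat\<close> from
  truncating.\<close>

lemma sum_shift_mod_3:
  fixes g :: "nat \<Rightarrow> nat \<Rightarrow> 'b::comm_monoid_add"
  assumes "i < 3"
  shows "(\<Sum>k<3. g k ((i + k) mod 3)) = (\<Sum>p<3. g ((p + 3 - i) mod 3) p)"
proof -
  have "i = 0 \<or> i = 1 \<or> i = 2" using assms by auto
  then show ?thesis
    by (elim disjE) (simp_all add: lessThan_3 numeral_2_eq_2 add_ac)
qed

context symbol_algebra_3
begin

definition of_coeffs :: "(nat \<Rightarrow> nat \<Rightarrow> 'k) \<Rightarrow> 'a" where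
  "of_coeffs c = (\<Sum>i<3. \<Sum>j<3. scale (c i j) (x ^ i * y ^ j))"

text \<open>Each of the \<open>j\<close> factors \<open>y\<close> passes each of the
  \<open>k\<close> factors \<open>x\<close>, and every single exchange contributes one
  \<omega>.\<close>

lemma y_x_power: "y ^ j * x ^ k = scale (\<omega> ^ (j * k)) (x ^ k * y ^ j)"
proof -
  have 1: "y ^ j * x = scale (\<omega> ^ j) (x * y ^ j)" for j
  proof (induction j)
    case (Suc j)
    have "y ^ Suc j * x = y * (y ^ j * x)" by (simp add: mult.assoc)
    also have "\<dots> = scale (\<omega> ^ j) ((y * x) * y ^ j)"
      by (simp add: Suc.IH scale_mult_right mult.assoc)
    also have "\<dots> = scale (\<omega> ^ Suc j) (x * y ^ Suc j)"
      by (simp add: y_x scale_mult_left scale_scale mult.assoc mult.commute[of _ \<omega>])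
    finally show ?case .
  qed simp
  show ?thesis
  proof (induction k)
    case (Suc k)
    have "y ^ j * x ^ Suc k = (y ^ j * x) * x ^ k" by (simp add: mult.assoc)
    also have "\<dots> = scale (\<omega> ^ j) (x * (y ^ j * x ^ k))"
      by (simp add: 1 scale_mult_left mult.assoc)
    also have "\<dots> = scale (\<omega> ^ (j * Suc k)) (x ^ Suc k * y ^ j)"
      by (simp add: Suc.IH scale_mult_right scale_scale mult.assoc power_add)
    finally show ?case .
  qed simp
qed

lemma monomial_mult:
  "(x ^ i * y ^ j) * (x ^ k * y ^ l)
    = scale (\<omega> ^ (j * k)) (x ^ ((i + k) mod 3) * y ^ ((j + l) mod 3))"
proof -
  have mod3: "z ^ m = z ^ (m mod 3)" if "z ^ 3 = 1" for z :: 'a and m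
    by (metis that mult.left_neutral mult_div_mod_eq power_add power_mult power_one)
  have "(x ^ i * y ^ j) * (x ^ k * y ^ l) = x ^ i * (y ^ j * x ^ k) * y ^ l"
    by (simp add: mult.assoc)
  also have "\<dots> = scale (\<omega> ^ (j * k)) (x ^ (i + k) * y ^ (j + l))"
    by (simp add: y_x_power scale_mult_left scale_mult_right mult.assoc power_add)
  finally show ?thesis
    using mod3[OF x_cube, of "i + k"] mod3[OF y_cube, of "j + l"] by simp
qed

text \<open>A twisted convolution over (Z/3)^2: the indices of the first factor and of the result
  determine those of the second, so a product can be verified entry by entry.\<close>

lemma of_coeffs_mult:
  "of_coeffs c * of_coeffs d = of_coeffs (\<lambda>p q. \<Sum>i<3. \<Sum>j<3.
     \<omega> ^ (j * ((p + 3 - i) mod 3)) * c i j * d ((p + 3 - i) mod 3) ((q + 3 - j) mod 3))"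
proof -
  let ?t = "\<lambda>i j p q.
      scale (\<omega> ^ (j * ((p + 3 - i) mod 3)) * c i j * d ((p + 3 - i) mod 3) ((q + 3 - j) mod 3))
        (x ^ p * y ^ q)"
  have "of_coeffs c * of_coeffs d = (\<Sum>i<3. \<Sum>j<3. \<Sum>k<3. \<Sum>l<3.
      scale (\<omega> ^ (j * k) * c i j * d k l) (x ^ ((i + k) mod 3) * y ^ ((j + l) mod 3)))"
    unfolding of_coeffs_def sum_distrib_right unfolding sum_distrib_left
    by (simp only: scale_mult_left scale_mult_right monomial_mult scale_scale mult_ac[where 'a = 'k])
  also have "\<dots> = (\<Sum>i<3. \<Sum>j<3. \<Sum>p<3. \<Sum>q<3. ?t i j p q)"
  proof (rule sum.cong[OF refl], rule sum.cong[OF refl])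
    fix i j :: nat
    assume "i \<in> {..<3}" "j \<in> {..<3}"
    then have "i < 3" "j < 3" by auto
    then show "(\<Sum>k<3. \<Sum>l<3.
        scale (\<omega> ^ (j * k) * c i j * d k l) (x ^ ((i + k) mod 3) * y ^ ((j + l) mod 3)))
        = (\<Sum>p<3. \<Sum>q<3. ?t i j p q)"
      by (subst sum_shift_mod_3[where g = "\<lambda>k m. \<Sum>l<3.
            scale (\<omega> ^ (j * k) * c i j * d k l) (x ^ m * y ^ ((j + l) mod 3))", OF \<open>i < 3\<close>])
        (rule sum.cong[OF refl], rule sum_shift_mod_3[OF \<open>j < 3\<close>])
  qed
  \<comment> \<open>The swaps bring the exponents \<open>p\<close>, \<open>q\<close> of the result
    to the outside, so that the coefficients of each monomial are collected.\<close>
  also have "\<dots> = (\<Sum>i<3. \<Sum>p<3. \<Sum>j<3. \<Sum>q<3. ?t i j p q)"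
    by (rule sum.cong[OF refl], rule sum.swap)
  also have "\<dots> = (\<Sum>p<3. \<Sum>i<3. \<Sum>j<3. \<Sum>q<3. ?t i j p q)"
    by (rule sum.swap)
  also have "\<dots> = (\<Sum>p<3. \<Sum>i<3. \<Sum>q<3. \<Sum>j<3. ?t i j p q)"
    by (rule sum.cong[OF refl], rule sum.cong[OF refl], rule sum.swap)
  also have "\<dots> = (\<Sum>p<3. \<Sum>q<3. \<Sum>i<3. \<Sum>j<3. ?t i j p q)"
    by (rule sum.cong[OF refl], rule sum.swap)
  finally show ?thesis by (simp add: of_coeffs_def scale_sum_left)
qed

lemma of_coeffs_cong:
  assumes "\<And>i j. i < 3 \<Longrightarrow> j < 3 \<Longrightarrow> c i j = d i j"
  shows "of_coeffs c = of_coeffs d"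
  using assms by (simp add: of_coeffs_def)

lemma of_coeffs_scalar: "of_coeffs (\<lambda>i j. if i = 0 \<and> j = 0 then c else 0) = scale c 1"
  by (simp add: of_coeffs_def lessThan_3)

lemma invertible_fib_symbol:
  assumes \<omega>: "\<omega>\<^sup>2 + \<omega> + 1 = 0" and char_0: "\<And>m. m > 0 \<Longrightarrow> (of_nat m :: 'k) \<noteq> 0"
  shows "is_invertible (fib_symbol scale x y n)"
proof -
  \<comment> \<open>\<open>e\<close> is the Cassini expression, with value (-1)^(n+1); below it is
    treated as a polynomial in \<open>a\<close> and \<open>b\<close>.\<close>
  define a b e :: 'k where "a = of_nat (fib n)" and "b = of_nat (fib (n + 1))"
    and "e = a\<^sup>2 + a * b - b\<^sup>2"
  \<comment> \<open>\<open>N\<close> is half the reduced norm, and \<open>g\<close> has the coefficients of half the reduced adjoint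
    \<open>F\<^sup>2 - Trd(F) F + (Trd(F)\<^sup>2 - Trd(F\<^sup>2)) / 2\<close>, where \<open>Trd\<close> is three times the constant coefficient.\<close>
  define N where "N = 632 * a ^ 3 + 3036 * a\<^sup>2 * b + 4884 * a * b\<^sup>2 + 2628 * b ^ 3"
  \<comment> \<open>Entry \<open>(i, j)\<close> is the Fibonacci number of index n + i + 3j, reduced
    to a combination of \<open>a\<close> and \<open>b\<close>.\<close>
  define f where "f = (\<lambda>i j.
      [[a, a + 2 * b, 5 * a + 8 * b],
       [b, 2 * a + 3 * b, 8 * a + 13 * b],
       [a + b, 3 * a + 5 * b, 13 * a + 21 * b]] ! i ! j)"
  define g where "g = (\<lambda>i j.
      [[11 * a\<^sup>2 + 31 * a * b + 23 * b\<^sup>2 + \<omega> * e,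
        - (40 * a\<^sup>2 + 128 * a * b + 102 * b\<^sup>2) - \<omega> * e,
        - e + 4 * \<omega> * e],
       [- (15 * a\<^sup>2 + 49 * a * b + 39 * b\<^sup>2) - \<omega> * e,
        - e + \<omega> * (63 * a\<^sup>2 + 205 * a * b + 167 * b\<^sup>2),
        - e + 3 * \<omega> * e],
       [- e + \<omega> * e, - e, - 4 * e + 3 * \<omega> * e]] ! i ! j)"
  \<comment> \<open>These rules bring polynomials in \<omega> to the form u + v \<omega>. The second
    serves right-nested products; \<omega>^4 comes from the twist \<open>j * k\<close> at
    \<open>j = k = 2\<close>.\<close>
  have reduce: "\<omega> * \<omega> = - 1 - \<omega>" "\<omega> * (\<omega> * t) = - t - \<omega> * t" "\<omega> ^ 4 = \<omega>" for t
    using \<omega> by algebra+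
  have fib: "fib_symbol scale x y n = of_coeffs f"
  proof -
    have fibs: "fib (n + 2) = fib n + fib (n + 1)" "fib (n + 3) = fib n + 2 * fib (n + 1)"
      "fib (n + 4) = 2 * fib n + 3 * fib (n + 1)" "fib (n + 5) = 3 * fib n + 5 * fib (n + 1)"
      "fib (n + 6) = 5 * fib n + 8 * fib (n + 1)" "fib (n + 7) = 8 * fib n + 13 * fib (n + 1)"
      "fib (n + 8) = 13 * fib n + 21 * fib (n + 1)"
      by (simp_all add: eval_nat_numeral)
    show ?thesis
      unfolding fib_symbol_def Let_def fibs
      by (simp add: of_coeffs_def f_def a_def b_def lessThan_3 add_ac)
  qed
  have products: "of_coeffs f * of_coeffs g = scale N 1" "of_coeffs g * of_coeffs f = scale N 1"
    unfolding of_coeffs_mult of_coeffs_scalar[symmetric]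
  proof (rule_tac [!] of_coeffs_cong)
    fix p q :: nat
    assume "p < 3" "q < 3"
    then have "p = 0 \<or> p = 1 \<or> p = 2" "q = 0 \<or> q = 1 \<or> q = 2" by auto
    then show "(\<Sum>i<3. \<Sum>j<3. \<omega> ^ (j * ((p + 3 - i) mod 3)) * f i j
        * g ((p + 3 - i) mod 3) ((q + 3 - j) mod 3)) = (if p = 0 \<and> q = 0 then N else 0)"
      and "(\<Sum>i<3. \<Sum>j<3. \<omega> ^ (j * ((p + 3 - i) mod 3)) * g i j
        * f ((p + 3 - i) mod 3) ((q + 3 - j) mod 3)) = (if p = 0 \<and> q = 0 then N else 0)"
      \<comment> \<open>For each of the nine entries, the first \<open>simp\<close> evaluates sums
        and tables with \<open>e\<close> kept opaque; the second expands \<open>e\<close> and leaves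
        a polynomial identity in \<open>a\<close>, \<open>b\<close>, \<omega>.\<close>
      by (elim disjE; simp add: f_def g_def N_def lessThan_3;
          simp add: e_def algebra_simps reduce power2_eq_square power3_eq_cube)+
  qed
  have "N \<noteq> 0"
  proof -
    have "N = of_nat (632 * fib n ^ 3 + 3036 * (fib n)\<^sup>2 * fib (n + 1)
        + 4884 * fib n * (fib (n + 1))\<^sup>2 + 2628 * fib (n + 1) ^ 3)"
      by (simp add: N_def a_def b_def)
    also have "\<dots> \<noteq> 0"
      \<comment> \<open>The last summand is already positive, since \<open>fib (n + 1) > 0\<close>
        even at \<open>n = 0\<close>.\<close>
      by (rule char_0) (simp add: fib_neq_0_nat)
    finally show ?thesis .
  qed
  with products have "of_coeffs f * scale (inverse N) (of_coeffs g) = 1"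
    "scale (inverse N) (of_coeffs g) * of_coeffs f = 1"
    by (simp_all add: scale_mult_left scale_mult_right)
  then show ?thesis
    unfolding is_invertible_def fib by blast
qed

end

theorem theorem4p7:
  fixes \<omega> :: "'k::field_char_0"
    and scale :: "'k \<Rightarrow> 'a::ring_1 \<Rightarrow> 'a"
    and x y :: 'a
  assumes "primitive_root_of_unity 3 \<omega>"
    and "rat_adjoin \<omega> = UNIV"
    and "symbol_algebra_3 scale \<omega> x y"
  shows "\<forall>n. is_invertible (fib_symbol scale x y n)"
proof -
  interpret symbol_algebra_3 scale \<omega> x y by fact
  show ?thesis
    using invertible_fib_symbol primitive_cube_root_eq[OF assms(1)] by simp
qed

end
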